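(* Let $C\in\mathbb{R}^{v\times v}$ be a symmetric positive semidefinite matrix and let $\gamma>1$ be a real number. Then the $v^2\times v^2$ real symmetric block matrix $$Q=\begin{bmatrix} \gamma\overline{C} & C/2 & 0 & \cdots & 0 & C/2\\ C^{\top}/2 & \gamma\overline{C} & C/2 & 0 & \cdots & 0\\ 0 & C^{\top}/2 & \ddots & \ddots & \ddots & \vdots\\ \vdots & \ddots & \ddots & \ddots & C/2 & 0\\ 0 & \cdots & 0 & C^{\top}/2 & \gamma\overline{C} & C/2\\ C^{\top}/2 & 0 & \cdots & 0 & C^{\top}/2 & \gamma\overline{C} \end{bmatrix}$$ (with $v\times v$ blocks, each of size $v\times v$) is positive semidefinite.
   Context: Here $v=2(n+k)+1$ where $n\ge 1$ and $k\ge 1$ are integers (so $v\ge 5$), and $\overline{C}=(C+C^{\top})/2$. The blocks of $Q$, indexed by $(r,s)\in\{1,\dots,v\}^2$, are: $\gamma\overline{C}$ if $r=s$; $C/2$ if $s=r+1$; $C^{\top}/2$ if $r=s+1$; $C/2$ if $(r,s)=(1,v)$; $C^{\top}/2$ if $(r,s)=(v,1)$; and the zero block otherwise. *)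

theory Defs
  imports Complex_Main "Jordan_Normal_Form.Matrix"
begin

definition symmetric_mat :: "'a mat \<Rightarrow> bool" where
  "symmetric_mat A \<longleftrightarrow> transpose_mat A = A"

text \<open>Symmetry (hence squareness) is part of the definition, as is usual over the reals.\<close>

definition pos_semidef_mat :: "real mat \<Rightarrow> bool" where
  "pos_semidef_mat A \<longleftrightarrow>
     symmetric_mat A \<and> (\<forall>x \<in> carrier_vec (dim_row A). 0 \<le> x \<bullet> (A *\<^sub>v x))"

definition sym_part :: "real mat \<Rightarrow> real mat" where
  "sym_part C = (1/2) \<cdot>\<^sub>m (C + transpose_mat C)"

text \<open>Block indices are 0-based, following the library's matrix indexing: block \<open>(r, s)\<close> here
  is block \<open>(r + 1, s + 1)\<close> in 1-based notation, so the corners are \<open>(0, v - 1)\<close> and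
  \<open>(v - 1, 0)\<close>. For \<open>v \<ge> 3\<close> the cases are mutually exclusive.\<close>

definition Q_block :: "nat \<Rightarrow> real \<Rightarrow> real mat \<Rightarrow> nat \<Rightarrow> nat \<Rightarrow> real mat" where
  "Q_block v \<gamma> C r s =
     (if r = s then \<gamma> \<cdot>\<^sub>m sym_part C
      else if s = r + 1 then (1/2) \<cdot>\<^sub>m C
      else if r = s + 1 then (1/2) \<cdot>\<^sub>m transpose_mat C
      else if r = 0 \<and> s = v - 1 then (1/2) \<cdot>\<^sub>m C
      else if r = v - 1 \<and> s = 0 then (1/2) \<cdot>\<^sub>m transpose_mat C
      else 0\<^sub>m v v)"

definition block_matrix :: "nat \<Rightarrow> nat \<Rightarrow> (nat \<Rightarrow> nat \<Rightarrow> 'a mat) \<Rightarrow> 'a mat" where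
  "block_matrix m d B =
     mat (m * d) (m * d) (\<lambda>(i, j). B (i div d) (j div d) $$ (i mod d, j mod d))"

definition Q_mat :: "nat \<Rightarrow> real \<Rightarrow> real mat \<Rightarrow> real mat" where
  "Q_mat v \<gamma> C = block_matrix v v (Q_block v \<gamma> C)"

end

theory Submission
  imports Defs
begin

text \<open>Since \<open>C\<close> is symmetric, \<open>Q\<close> is the Kronecker product of a circulant matrix with \<open>C\<close>. Splitting
  \<open>x\<close> into blocks \<open>x\<^sub>r\<close> and writing \<open>B r s\<close> for \<open>x\<^sub>r \<bullet> C x\<^sub>s\<close>, the quadratic form of \<open>Q\<close> is
  \<open>\<gamma> * (\<Sum>r. B r r) + (\<Sum>r. B r (r + 1))\<close> with cyclic indices. Positivity of \<open>C\<close> at \<open>x\<^sub>r + x\<^sub>s\<close>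
  gives \<open>B r s \<ge> - (B r r + B s s) / 2\<close>, so the form is at least \<open>(\<gamma> - 1) * (\<Sum>r. B r r) \<ge> 0\<close>.\<close>

text \<open>The circulant Kronecker factor. Reduction \<open>mod v\<close> absorbs the two corner
  blocks, and a sum of indicators, unlike nested cases, lets the quadratic form split into three
  sums.\<close>

definition cyclic_coeff :: "nat \<Rightarrow> real \<Rightarrow> nat \<Rightarrow> nat \<Rightarrow> real" where
  "cyclic_coeff v \<gamma> r s =
     (if r = s then \<gamma> else 0)
     + (if s = Suc r mod v then 1/2 else 0)
     + (if r = Suc s mod v then 1/2 else 0)"

lemma sum_lessThan_mult_blocks:
  fixes f :: "nat \<Rightarrow> 'a::comm_monoid_add"
  shows "(\<Sum>i<m * d. f i) = (\<Sum>r<m. \<Sum>a<d. f (r * d + a))"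
proof -
  have "sum f {r * d..<r * d + d} = (\<Sum>a<d. f (r * d + a))" for r
    using sum.shift_bounds_nat_ivl[of f 0 "r * d" d]
    by (simp add: add.commute atLeast0LessThan)
  then show ?thesis
    by (simp add: sum.nat_group[symmetric])
qed

lemma quadratic_form_eq_double_sum:
  assumes "A \<in> carrier_mat n n" "x \<in> carrier_vec n" "y \<in> carrier_vec n"
  shows "x \<bullet> (A *\<^sub>v y) = (\<Sum>i<n. \<Sum>j<n. x $ i * A $$ (i, j) * y $ j)"
  using assms
  by (auto simp: scalar_prod_def sum_distrib_left atLeast0LessThan mult.assoc intro!: sum.cong)

text \<open>The successor modulo \<open>v\<close> permutes the indices: only the last one wraps,
  supplying \<open>g 0\<close>.\<close>

lemma sum_cyclic_shift:
  fixes g :: "nat \<Rightarrow> 'a::comm_monoid_add"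
  shows "(\<Sum>r<v. g (Suc r mod v)) = (\<Sum>r<v. g r)"
proof (cases v)
  case (Suc m)
  have "(\<Sum>r<Suc m. g (Suc r mod Suc m)) = (\<Sum>r<m. g (Suc r)) + g 0"
    by (simp add: mod_less)
  also have "\<dots> = (\<Sum>r<Suc m. g r)"
    by (simp add: sum.lessThan_Suc_shift add.commute del: sum.lessThan_Suc)
  finally show ?thesis using Suc by simp
qed simp

lemma cyclic_form_nonneg:
  fixes B :: "nat \<Rightarrow> nat \<Rightarrow> real"
  assumes sym: "\<And>r s. B r s = B s r"
    and diag: "\<And>r. 0 \<le> B r r"
    and cross: "\<And>r s. 0 \<le> B r r + 2 * B r s + B s s"
    and "\<gamma> \<ge> 1"
  shows "0 \<le> (\<Sum>r<v. \<Sum>s<v. cyclic_coeff v \<gamma> r s * B r s)"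
proof -
  have d: "(\<Sum>r<v. \<Sum>s<v. (if r = s then \<gamma> else 0) * B r s) = \<gamma> * (\<Sum>r<v. B r r)"
    by (simp add: if_distrib[of "\<lambda>t. t * _"] sum_distrib_left cong: if_cong)
  have u: "(\<Sum>r<v. \<Sum>s<v. (if s = Suc r mod v then 1/2 else 0) * B r s)
      = (\<Sum>r<v. B r (Suc r mod v)) / 2"
    by (simp add: if_distrib[of "\<lambda>t. t * _"] sum_divide_distrib cong: if_cong)
  have l: "(\<Sum>r<v. \<Sum>s<v. (if r = Suc s mod v then 1/2 else 0) * B r s)
      = (\<Sum>r<v. B r (Suc r mod v)) / 2"
    \<comment> \<open>Exchanging the roles of \<open>r\<close> and \<open>s\<close> and using
      symmetry of \<open>B\<close> turns the lower diagonal into the upper one.\<close>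
    by (subst sum.swap, subst sym) (rule u)
  \<comment> \<open>Adding \<open>cross\<close> over all cyclic neighbours counts each diagonal term
    twice, once as \<open>r\<close> and once as a successor.\<close>
  have "0 \<le> (\<Sum>r<v. B r r + 2 * B r (Suc r mod v) + B (Suc r mod v) (Suc r mod v))"
    by (intro sum_nonneg cross)
  also have "\<dots> = 2 * (\<Sum>r<v. B r r) + 2 * (\<Sum>r<v. B r (Suc r mod v))"
    by (simp add: sum.distrib sum_distrib_left sum_cyclic_shift[of "\<lambda>r. B r r"])
  finally have "0 \<le> (\<Sum>r<v. B r r) + (\<Sum>r<v. B r (Suc r mod v))"
    by simp
  moreover have "(\<Sum>r<v. B r r) \<le> \<gamma> * (\<Sum>r<v. B r r)"
    using mult_right_mono[OF \<open>\<gamma> \<ge> 1\<close>, of "\<Sum>r<v. B r r"] by (simp add: sum_nonneg diag)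
  ultimately show ?thesis
    by (simp add: cyclic_coeff_def distrib_right sum.distrib d u l)
qed

text \<open>For \<open>v \<ge> 3\<close> at most one indicator in \<open>cyclic_coeff\<close> is
  nonzero, matching the exclusive cases of \<open>Q_block\<close>. For \<open>v = 2\<close> both
  neighbours coincide and the coefficient would be 1 instead of 1/2.\<close>

lemma Q_block_eq_cyclic_coeff:
  assumes "v \<ge> 3" "C \<in> carrier_mat v v" "symmetric_mat C" "r < v" "s < v"
  shows "Q_block v \<gamma> C r s = cyclic_coeff v \<gamma> r s \<cdot>\<^sub>m C"
proof -
  have CT: "transpose_mat C = C"
    using assms(3) by (simp add: symmetric_mat_def)
  have "sym_part C = C"
    unfolding sym_part_def CT using assms(2) by (intro eq_matI) auto
  moreover have "Suc i mod v = (if i = v - 1 then 0 else Suc i)" if "i < v" for i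
    using that by (auto simp: mod_less)
  moreover have "0\<^sub>m v v = 0 \<cdot>\<^sub>m C"
    using assms(2) by (intro eq_matI) auto
  ultimately show ?thesis
    using assms(1,4,5) by (auto simp: Q_block_def cyclic_coeff_def CT)
qed

lemma Q_mat_carrier: "Q_mat v \<gamma> C \<in> carrier_mat (v * v) (v * v)"
  by (simp add: Q_mat_def block_matrix_def)

lemma Q_mat_index:
  assumes "v \<ge> 3" "C \<in> carrier_mat v v" "symmetric_mat C" "i < v * v" "j < v * v"
  shows "Q_mat v \<gamma> C $$ (i, j)
    = cyclic_coeff v \<gamma> (i div v) (j div v) * C $$ (i mod v, j mod v)"
  using assms
  by (simp add: Q_mat_def block_matrix_def Q_block_eq_cyclic_coeff less_mult_imp_div_less)

lemma symmetric_mat_index: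
  assumes "symmetric_mat C" "C \<in> carrier_mat n n" "i < n" "j < n"
  shows "C $$ (i, j) = C $$ (j, i)"
  using assms by (metis carrier_matD index_transpose_mat(1) symmetric_mat_def)

text \<open>Both Kronecker factors are symmetric: swapping the block indices merely exchanges the
  last two indicators of \<open>cyclic_coeff\<close>.\<close>

lemma Q_mat_symmetric:
  assumes "v \<ge> 3" "C \<in> carrier_mat v v" "symmetric_mat C"
  shows "symmetric_mat (Q_mat v \<gamma> C)"
proof -
  have "Q_mat v \<gamma> C $$ (j, i) = Q_mat v \<gamma> C $$ (i, j)" if "i < v * v" "j < v * v" for i j
  proof -
    have "C $$ (j mod v, i mod v) = C $$ (i mod v, j mod v)"
      using assms by (intro symmetric_mat_index[of C v]) auto
    then show ?thesis
      using assms that by (auto simp: Q_mat_index cyclic_coeff_def)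
  qed
  then show ?thesis
    unfolding symmetric_mat_def using Q_mat_carrier[of v \<gamma> C] by (intro eq_matI) auto
qed

lemma Q_mat_form_nonneg:
  assumes v: "v \<ge> 3" and C: "C \<in> carrier_mat v v" and psd: "pos_semidef_mat C"
    and "\<gamma> \<ge> 1" and x: "x \<in> carrier_vec (v * v)"
  shows "0 \<le> x \<bullet> (Q_mat v \<gamma> C *\<^sub>v x)"
proof -
  have sC: "symmetric_mat C"
    using psd by (simp add: pos_semidef_mat_def)
  have q: "0 \<le> y \<bullet> (C *\<^sub>v y)" if "y \<in> carrier_vec v" for y
    using psd C that by (simp add: pos_semidef_mat_def)
  \<comment> \<open>For \<open>r \<ge> v\<close> the entries are unspecified, but \<open>X r\<close>
    still has dimension \<open>v\<close>, so the facts about \<open>B\<close> below hold for all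
    indices, as \<open>cyclic_form_nonneg\<close> demands.\<close>
  define X where "X r = vec v (\<lambda>a. x $ (r * v + a))" for r
  define B where "B r s = X r \<bullet> (C *\<^sub>v X s)" for r s
  have X: "X r \<in> carrier_vec v" for r
    by (simp add: X_def)
  have B_sum: "B r s = (\<Sum>a<v. \<Sum>b<v. x $ (r * v + a) * C $$ (a, b) * x $ (s * v + b))" for r s
    unfolding B_def by (subst quadratic_form_eq_double_sum[OF C X X]) (simp add: X_def)
  have sym: "B r s = B s r" for r s
    unfolding B_sum
    by (subst sum.swap, intro sum.cong refl)
      (use symmetric_mat_index[OF sC C] in \<open>simp add: mult.commute mult.left_commute\<close>)
  have cross: "0 \<le> B r r + 2 * B r s + B s s" for r s
  proof -
    have "0 \<le> (X r + X s) \<bullet> (C *\<^sub>v (X r + X s))"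
      using X by (intro q) simp
    also have "\<dots> = B r r + B r s + (B s r + B s s)"
      using X C unfolding B_def
      by (simp add: mult_add_distrib_mat_vec[OF C X X] add_scalar_prod_distrib[of _ v]
          scalar_prod_add_distrib[of _ v])
    finally show ?thesis
      using sym[of s r] by simp
  qed
  have lt: "r * v + a < v * v" if "r < v" "a < v" for r a
    using that by (simp add: div_less_iff_less_mult[symmetric])
  have "x \<bullet> (Q_mat v \<gamma> C *\<^sub>v x)
      = (\<Sum>r<v. \<Sum>a<v. \<Sum>s<v. \<Sum>b<v.
          x $ (r * v + a) * Q_mat v \<gamma> C $$ (r * v + a, s * v + b) * x $ (s * v + b))"
    by (simp add: quadratic_form_eq_double_sum[OF Q_mat_carrier x x] sum_lessThan_mult_blocks)
  also have "\<dots> = (\<Sum>r<v. \<Sum>a<v. \<Sum>s<v. \<Sum>b<v.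
      cyclic_coeff v \<gamma> r s * (x $ (r * v + a) * C $$ (a, b) * x $ (s * v + b)))"
    by (intro sum.cong refl) (simp add: Q_mat_index[OF v C sC] lt)
  also have "\<dots> = (\<Sum>r<v. \<Sum>s<v. cyclic_coeff v \<gamma> r s * B r s)"
    \<comment> \<open>Interchanging the sums over \<open>a\<close> and \<open>s\<close> brings the
      offset sums together, where they form \<open>B r s\<close>.\<close>
    by (subst sum.swap[of _ "{..<v}" "{..<v}"]) (simp add: B_sum sum_distrib_left)
  also have "\<dots> \<ge> 0"
    using sym cross q[OF X] \<open>\<gamma> \<ge> 1\<close> by (intro cyclic_form_nonneg) (auto simp: B_def)
  finally show ?thesis .
qed

theorem propositionB3:
  fixes n k v :: nat and C :: "real mat" and \<gamma> :: real
  assumes "n \<ge> 1" and "k \<ge> 1" and "v = 2 * (n + k) + 1"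
    and "C \<in> carrier_mat v v"
    and "pos_semidef_mat C"
    and "\<gamma> > 1"
  shows "pos_semidef_mat (Q_mat v \<gamma> C)"
proof -
  have "v \<ge> 3"
    using assms(1-3) by simp
  moreover have "symmetric_mat C"
    using assms(5) by (simp add: pos_semidef_mat_def)
  ultimately show ?thesis
    using assms(4-6) Q_mat_symmetric Q_mat_form_nonneg Q_mat_carrier[of v \<gamma> C]
    by (auto simp: pos_semidef_mat_def[of "Q_mat v \<gamma> C"])
qed

end
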